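(* Let $n\ge 2$ and let $X_n=\{x_0,x_1,\ldots,x_n\}$, regarded as a generating set for Thompson's group $F$. Then $F$ is not minimally almost convex with respect to $X_n$.
   Context: Thompson's group $F$ is the group with presentation $\langle x_k,\ k\ge 0 \mid x_i^{-1}x_jx_i=x_{j+1}\ \text{if } i<j\rangle$; $\{x_k : k\ge 0\}$ is its standard infinite generating set. For a group $G$ with finite generating set $X$, $\Gamma(G,X)$ denotes the Cayley graph with vertex set $G$ and edges joining $g$ to $gx$ for $x\in X^{\pm1}$; all edges have length 1, and $d_X(g,h)$ (the least $n$ such that $g^{-1}h$ is a product of $n$ elements of $X^{\pm1}$) is the resulting word metric. $B(m)$ denotes the ball of radius $m$ centered at the identity; paths are edge paths in $\Gamma(G,X)$. Minimally almost convex: $G$ is minimally almost convex with respect to $X$ if, for all sufficiently large $m$, any two elements of $B(m)$ at distance $2$ can be joined by a path of length at most $2m-1$ lying in $B(m)$. *)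

theory Defs
  imports "HOL-Algebra.Generated_Groups"
begin

section \<open>Groups given by generators and relations\<close>

text \<open>A word is a list of letters; the letter \<open>(a, True)\<close> stands for the generator \<open>a\<close>
  and \<open>(a, False)\<close> for its formal inverse. The generators are all elements of the type \<open>'a\<close>;
  a pair \<open>(r, s) \<in> R\<close> is the relation \<open>r = s\<close>.\<close>

type_synonym 'a word = "('a \<times> bool) list"

inductive_set word_eq :: "('a word \<times> 'a word) set \<Rightarrow> ('a word \<times> 'a word) set"
  for R :: "('a word \<times> 'a word) set"
  where
    refl: "(u, u) \<in> word_eq R"
  | sym: "(u, v) \<in> word_eq R \<Longrightarrow> (v, u) \<in> word_eq R"
  | trans: "(u, v) \<in> word_eq R \<Longrightarrow> (v, w) \<in> word_eq R \<Longrightarrow> (u, w) \<in> word_eq R"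
  | cancel: "(u @ [(a, b), (a, \<not> b)] @ v, u @ v) \<in> word_eq R"
  | rel: "(r, s) \<in> R \<Longrightarrow> (u @ r @ v, u @ s @ v) \<in> word_eq R"

definition presented_group :: "('a word \<times> 'a word) set \<Rightarrow> 'a word set monoid" where
  "presented_group R =
    \<lparr>carrier = UNIV // word_eq R,
     mult = (\<lambda>A B. \<Union>u\<in>A. \<Union>v\<in>B. word_eq R `` {u @ v}),
     one = word_eq R `` {[]}\<rparr>"

lemma equiv_word_eq: "equiv UNIV (word_eq R)"
  by (intro equivI refl_onI symI transI) (auto intro: word_eq.intros)

lemma word_eq_append_left: "(u, v) \<in> word_eq R \<Longrightarrow> (w @ u, w @ v) \<in> word_eq R"
proof (induction rule: word_eq.induct)
  case (cancel u a b v)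
  show ?case using word_eq.cancel[of "w @ u" a b v R] by simp
next
  case (rel r s u v)
  then show ?case using word_eq.rel[of r s R "w @ u" v] by simp
qed (auto intro: word_eq.intros)

lemma word_eq_append_right: "(u, v) \<in> word_eq R \<Longrightarrow> (u @ w, v @ w) \<in> word_eq R"
proof (induction rule: word_eq.induct)
  case (cancel u a b v)
  show ?case using word_eq.cancel[of u a b "v @ w" R] by simp
next
  case (rel r s u v)
  then show ?case using word_eq.rel[of r s R u "v @ w"] by simp
qed (auto intro: word_eq.intros)

lemma mult_class:
  "word_eq R `` {u} \<otimes>\<^bsub>presented_group R\<^esub> word_eq R `` {v} = word_eq R `` {u @ v}"
proof -
  have "congruent2 (word_eq R) (word_eq R) (\<lambda>u v. word_eq R `` {u @ v})"
    by (rule congruent2I[OF equiv_word_eq equiv_word_eq])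
      (auto intro!: equiv_class_eq[OF equiv_word_eq] word_eq_append_left word_eq_append_right)
  then show ?thesis
    using UN_equiv_class2[OF equiv_word_eq equiv_word_eq]
    by (simp add: presented_group_def)
qed

lemma carrier_presented_group: "carrier (presented_group R) = range (\<lambda>u. word_eq R `` {u})"
  by (auto simp: presented_group_def quotient_def)

lemma one_presented_group: "\<one>\<^bsub>presented_group R\<^esub> = word_eq R `` {[]}"
  by (simp add: presented_group_def)

lemma word_eq_inverse:
  "(rev (map (\<lambda>(a, b). (a, \<not> b)) u) @ u, []) \<in> word_eq R"
proof (induction u)
  case Nil
  show ?case by (simp add: word_eq.refl)
next
  case (Cons x u)
  obtain a b where x: "x = (a, b)" by (cases x)
  let ?U = "rev (map (\<lambda>(a, b). (a, \<not> b)) u)"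
  have "(?U @ [(a, \<not> b), (a, \<not> \<not> b)] @ u, ?U @ u) \<in> word_eq R"
    by (rule word_eq.cancel)
  then show ?case using Cons word_eq.trans by (fastforce simp: x)
qed

lemma group_presented_group: "group (presented_group R)"
proof (rule groupI)
  fix x assume "x \<in> carrier (presented_group R)"
  then obtain u where "x = word_eq R `` {u}" by (auto simp: carrier_presented_group)
  then have "word_eq R `` {rev (map (\<lambda>(a, b). (a, \<not> b)) u)} \<otimes>\<^bsub>presented_group R\<^esub> x
      = \<one>\<^bsub>presented_group R\<^esub>"
    using equiv_class_eq[OF equiv_word_eq word_eq_inverse]
    by (simp add: mult_class one_presented_group)
  then show "\<exists>y\<in>carrier (presented_group R). y \<otimes>\<^bsub>presented_group R\<^esub> x = \<one>\<^bsub>presented_group R\<^esub>"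
    by (auto simp: carrier_presented_group)
qed (auto simp: carrier_presented_group mult_class one_presented_group)


section \<open>Thompson's group \<open>F\<close>\<close>

definition thompson_F :: "nat word set monoid" where
  "thompson_F = presented_group
    {([(i, False), (j, True), (i, True)], [(Suc j, True)]) | i j. i < j}"

definition thompson_gen :: "nat \<Rightarrow> nat word set" where
  "thompson_gen k =
    word_eq {([(i, False), (j, True), (i, True)], [(Suc j, True)]) | i j. i < j} `` {[(k, True)]}"


section \<open>Word metrics, Cayley graphs and minimal almost convexity\<close>

definition sym_gens :: "('a, 'b) monoid_scheme \<Rightarrow> 'a set \<Rightarrow> 'a set" where
  "sym_gens G X = X \<union> (\<lambda>x. inv\<^bsub>G\<^esub> x) ` X"

text \<open>The least number is only meaningful if \<open>X\<close> generates \<open>G\<close>; for the generating sets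
  considered here see \<open>generate_thompson_F\<close> below.\<close>

definition word_dist :: "('a, 'b) monoid_scheme \<Rightarrow> 'a set \<Rightarrow> 'a \<Rightarrow> 'a \<Rightarrow> nat" where
  "word_dist G X g h =
    (LEAST n. \<exists>xs. length xs = n \<and> set xs \<subseteq> sym_gens G X \<and>
       inv\<^bsub>G\<^esub> g \<otimes>\<^bsub>G\<^esub> h = foldr (\<otimes>\<^bsub>G\<^esub>) xs \<one>\<^bsub>G\<^esub>)"

definition word_ball :: "('a, 'b) monoid_scheme \<Rightarrow> 'a set \<Rightarrow> nat \<Rightarrow> 'a set" where
  "word_ball G X m = {g \<in> carrier G. word_dist G X \<one>\<^bsub>G\<^esub> g \<le> m}"

definition cayley_adj :: "('a, 'b) monoid_scheme \<Rightarrow> 'a set \<Rightarrow> 'a \<Rightarrow> 'a \<Rightarrow> bool" where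
  "cayley_adj G X g h \<longleftrightarrow> g \<in> carrier G \<and> (\<exists>x\<in>sym_gens G X. h = g \<otimes>\<^bsub>G\<^esub> x)"

text \<open>An edge path is given by its list of vertices, so a path of length \<open>l\<close> has
  \<open>l + 1\<close> vertices.\<close>

definition cayley_path :: "('a, 'b) monoid_scheme \<Rightarrow> 'a set \<Rightarrow> 'a \<Rightarrow> 'a list \<Rightarrow> 'a \<Rightarrow> bool" where
  "cayley_path G X g p h \<longleftrightarrow>
    p \<noteq> [] \<and> set p \<subseteq> carrier G \<and> hd p = g \<and> last p = h \<and> successively (cayley_adj G X) p"

definition path_length :: "'a list \<Rightarrow> nat" where
  "path_length p = length p - 1"

text \<open>A path lies in the ball if all its vertices do. For \<open>F\<close> this agrees with also requiring
  the interior of its edges to lie in the metric ball: all relations have even length, so no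
  edge joins two vertices at the same distance from the identity.\<close>

definition minimally_almost_convex :: "('a, 'b) monoid_scheme \<Rightarrow> 'a set \<Rightarrow> bool" where
  "minimally_almost_convex G X \<longleftrightarrow>
    (\<exists>M. \<forall>m\<ge>M. \<forall>g\<in>word_ball G X m. \<forall>h\<in>word_ball G X m.
       word_dist G X g h = 2 \<longrightarrow>
       (\<exists>p. cayley_path G X g p h \<and> path_length p \<le> 2 * m - 1 \<and> set p \<subseteq> word_ball G X m))"


section \<open>\<open>F\<close> is a group generated by \<open>x\<^sub>0, \<dots>, x\<^sub>n\<close>\<close>

lemma group_thompson_F: "group thompson_F"
  unfolding thompson_F_def by (rule group_presented_group)

lemma thompson_gen_closed: "thompson_gen k \<in> carrier thompson_F"
  by (auto simp: thompson_gen_def thompson_F_def carrier_presented_group)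

lemma inv_thompson_gen:
  "inv\<^bsub>thompson_F\<^esub> thompson_gen k =
    word_eq {([(i, False), (j, True), (i, True)], [(Suc j, True)]) | i j. i < j} `` {[(k, False)]}"
proof -
  interpret group thompson_F by (rule group_thompson_F)
  let ?R = "{([(i, False), (j, True), (i, True)], [(Suc j, True)]) | i j :: nat. i < j}"
  have "word_eq ?R `` {[(k, False)]} \<otimes>\<^bsub>thompson_F\<^esub> thompson_gen k = \<one>\<^bsub>thompson_F\<^esub>"
    using equiv_class_eq[OF equiv_word_eq word_eq_inverse[of "[(k, True)]" ?R]]
    by (simp add: thompson_F_def thompson_gen_def mult_class one_presented_group)
  moreover have "word_eq ?R `` {[(k, False)]} \<in> carrier thompson_F"
    by (auto simp: thompson_F_def carrier_presented_group)
  ultimately show ?thesis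
    using thompson_gen_closed inv_equality by blast
qed

lemma thompson_relation:
  assumes "i < j"
  shows "inv\<^bsub>thompson_F\<^esub> thompson_gen i \<otimes>\<^bsub>thompson_F\<^esub> thompson_gen j \<otimes>\<^bsub>thompson_F\<^esub> thompson_gen i
    = thompson_gen (Suc j)"
proof -
  let ?R = "{([(i, False), (j, True), (i, True)], [(Suc j, True)]) | i j :: nat. i < j}"
  have "([(i, False), (j, True), (i, True)], [(Suc j, True)]) \<in> word_eq ?R"
    using word_eq.rel[of _ _ ?R "[]" "[]"] assms by auto
  then show ?thesis
    using equiv_class_eq[OF equiv_word_eq]
    unfolding inv_thompson_gen
    by (simp add: thompson_F_def thompson_gen_def mult_class)
qed

lemma generate_thompson_F:
  assumes "n \<ge> 1"
  shows "generate thompson_F (thompson_gen ` {0..n}) = carrier thompson_F"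
proof
  interpret group thompson_F by (rule group_thompson_F)
  let ?S = "generate thompson_F (thompson_gen ` {0..n})"
  let ?R = "{([(i, False), (j, True), (i, True)], [(Suc j, True)]) | i j :: nat. i < j}"
  have sub: "thompson_gen ` {0..n} \<subseteq> carrier thompson_F"
    using thompson_gen_closed by auto
  show "?S \<subseteq> carrier thompson_F"
    by (rule generate_incl[OF sub])
  have 0: "thompson_gen 0 \<in> ?S"
    by (rule generate.incl) simp
  have Suc: "thompson_gen (Suc k) \<in> ?S" for k
  proof (induction k)
    case 0
    show ?case by (rule generate.incl) (use assms in auto)
  next
    case (Suc k)
    have "inv\<^bsub>thompson_F\<^esub> thompson_gen 0 \<in> ?S"
      by (rule generate_m_inv_closed[OF sub 0])
    then have "inv\<^bsub>thompson_F\<^esub> thompson_gen 0 \<otimes>\<^bsub>thompson_F\<^esub> thompson_gen (Suc k)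
        \<otimes>\<^bsub>thompson_F\<^esub> thompson_gen 0 \<in> ?S"
      using Suc 0 by (blast intro: generate.eng)
    then show ?case by (simp add: thompson_relation)
  qed
  have gen: "thompson_gen k \<in> ?S" for k
    using 0 Suc by (cases k) auto
  have "word_eq ?R `` {u} \<in> ?S" for u
  proof (induction u)
    case Nil
    show ?case
      using generate.one[of thompson_F] by (simp add: thompson_F_def one_presented_group)
  next
    case (Cons x u)
    obtain k b where x: "x = (k, b)" by (cases x)
    have "word_eq ?R `` {[x]} \<in> ?S"
      using gen[of k] generate_m_inv_closed[OF sub gen[of k]]
      unfolding inv_thompson_gen x by (cases b) (simp_all add: thompson_gen_def)
    from generate.eng[OF this Cons] show ?case
      by (simp add: thompson_F_def mult_class)
  qed
  then show "carrier thompson_F \<subseteq> ?S"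
    by (auto simp: thompson_F_def carrier_presented_group)
qed

end

theory Submission
  imports Defs "HOL-Library.Stream"
begin

text \<open>Thompson's group acts on the line from the right: \<open>x\<^sub>0\<close> translates by one, and
  \<open>x\<^sub>k\<close> with \<open>k \<ge> 1\<close> fixes everything to the left of the \<open>k\<close>-th unit interval, stretches that
  interval to length two and pushes everything to the right of it by one. A word builds up
  a deformation of the line letter by letter. With the letters \<open>x\<^sub>0, \<dots>, x\<^sub>n\<close> and their inverses
  the slope at a point changes only while the point is in one of the intervals \<open>1, \<dots>, n + 1\<close>.

  Let \<open>N \<ge> 2\<close>, \<open>c = x\<^sub>1\<^sup>N x\<^sub>0 x\<^sub>1\<^sup>-\<^sup>N\<close>, \<open>l = x\<^sub>n c\<close>, \<open>r = c x\<^sub>0\<^sup>-\<^sup>1\<close> and \<open>m = 2 N + 2\<close>. Both elements lie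
  in the ball of radius \<open>m\<close>. As \<open>n \<ge> 2\<close>, we have \<open>x\<^sub>n c = c x\<^sub>n\<^sub>+\<^sub>1\<close> and \<open>x\<^sub>n\<^sub>+\<^sub>1 x\<^sub>0\<^sup>-\<^sup>1 = x\<^sub>0\<^sup>-\<^sup>1 x\<^sub>n\<close>, so
  \<open>r = l x\<^sub>0\<^sup>-\<^sup>1 x\<^sub>n\<^sup>-\<^sup>1\<close>. Every path from \<open>l\<close> to \<open>r\<close> in the ball has length at least \<open>2 m\<close>, for the
  following reason.

  In \<open>l\<close> the right end of the \<open>n\<close>-th interval, the gate, is stretched; in \<open>r\<close> it is not. So a path
  from \<open>l\<close> to \<open>r\<close> has a vertex \<open>h\<close> at which the gate is stretched but the next letter compresses it,
  and then the image of the gate is in an interval numbered at most \<open>n + 1\<close>. Now count displacements.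
  Each generator that acts to the left of the gate pushes it to the right, each inverse
  pulls it back, and the two kinds of letters nearly balance, since the gate ends about where it
  began. Hence, up to the net displacement, the length of a word is at least twice the number of the
  positive letters that other considerations force to occur (\<open>length_bound\<close>). A word of
  length at most \<open>m\<close> for \<open>h\<close> has at most \<open>N + 1\<close> relevant positive letters, one of which stretches
  the gate. Therefore it does not contain \<open>x\<^sub>0\<close>, and then the points up to \<open>0\<close> are still undeformed in
  \<open>h\<close>, or else it never stretches the points next to \<open>0\<close> on the right by \<open>2\<^sup>N\<close>
  (\<open>history_dichotomy\<close>). But \<open>c\<close> compresses the interval left of \<open>0\<close> by \<open>2\<^sup>N\<close>, and its break
  at \<open>2\<^sup>-\<^sup>N\<close> can be created or removed only at a moment when the points next to it are stretched by
  \<open>2\<^sup>N\<close> (\<open>tips_split\<close>). In both cases a path from \<open>l\<close> to \<open>h\<close>, as well as one from \<open>r\<close> to \<open>h\<close>, contains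
  \<open>N\<close> stretchings of one point left of the gate. The second one must in addition stretch the gate and
  use \<open>x\<^sub>0\<close>. By the same count (\<open>undoing_cost\<close>) the two paths have lengths at least \<open>2 N + 1\<close> and
  \<open>2 N + 3\<close>, in total \<open>4 N + 4 = 2 m\<close>.\<close>

section \<open>The action of Thompson's group on points of the line\<close>

declare One_nat_def [simp del]

text \<open>The germ of a deformation at a one-sided dyadic point: the image lies in the unit interval with
  number \<open>leaf\<close>, at the binary digits \<open>addr\<close>, and the slope there is \<open>2\<close> to the power \<open>- depth\<close>.
  Digit streams separate the two sides of a dyadic point, so that slopes are always defined.
  The \<open>level\<close> counts the generators minus the inverses that moved or stretched something at or to the left
  of the point; it is part of the state because it then depends on the group element
  alone, not on the word.\<close>

datatype track = Track (leaf: int) (addr: "bool stream") (depth: int) (level: int)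

fun up :: "nat \<Rightarrow> track \<Rightarrow> track" where
  "up k (Track j s d t) =
    (if k > 0 \<and> j < int k then Track j s d t
     else if k > 0 \<and> j = int k then Track (if shd s then j + 1 else j) (stl s) (d - 1) (t + 1)
     else Track (j + 1) s d (t + 1))"

fun down :: "nat \<Rightarrow> track \<Rightarrow> track" where
  "down k (Track j s d t) =
    (if k > 0 \<and> j < int k then Track j s d t
     else if k > 0 \<and> j \<le> int k + 1 then Track (int k) ((j = int k + 1) ## s) (d + 1) (t - 1)
     else Track (j - 1) s d (t - 1))"

definition step :: "nat \<times> bool \<Rightarrow> track \<Rightarrow> track" where
  "step x = (if snd x then up (fst x) else down (fst x))"

definition act :: "nat word \<Rightarrow> track \<Rightarrow> track" where
  "act w = fold step w"

lemma act_simps [simp]: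
  "act [] p = p" "act (x # w) p = act w (step x p)" "act (v @ w) p = act w (act v p)"
  by (simp_all add: act_def)

lemma step_simps [simp]: "step (k, True) = up k" "step (k, False) = down k"
  by (simp_all add: step_def)

lemma down_up [simp]: "down k (up k p) = p"
proof (cases p)
  case (Track j s d t)
  then show ?thesis using stream.collapse[of s] by (cases "shd s") auto
qed

lemma up_down [simp]: "up k (down k p) = p"
  by (cases p) auto

lemma step_cancel: "step (k, \<not> b) (step (k, b) p) = p"
  by (cases b) simp_all

text \<open>The defining relations hold for all four components, which makes the action well defined on \<open>F\<close>.\<close>

lemma up_conj: "i < j \<Longrightarrow> up i (up j (down i p)) = up (Suc j) p"
  by (cases p) auto

abbreviation F_rels :: "(nat word \<times> nat word) set" where
  "F_rels \<equiv> {([(i, False), (j, True), (i, True)], [(Suc j, True)]) | i j. i < j}"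

lemma act_word_eq: "(u, v) \<in> word_eq F_rels \<Longrightarrow> act u p = act v p"
proof (induction arbitrary: p rule: word_eq.induct)
  case (cancel u a b v)
  show ?case by (simp add: step_cancel)
next
  case (rel r s u v)
  then show ?case by (auto simp: up_conj)
qed simp_all

definition inv_word :: "nat word \<Rightarrow> nat word" where
  "inv_word w = rev (map (\<lambda>(a, b). (a, \<not> b)) w)"

lemma inv_word_simps [simp]:
  "inv_word [] = []" "inv_word (v @ w) = inv_word w @ inv_word v"
  "length (inv_word w) = length w" "inv_word (inv_word w) = w"
  by (simp_all add: inv_word_def rev_map[symmetric] comp_def case_prod_beta)

lemma act_inv_word [simp]: "act (inv_word w) (act w p) = p"
proof (induction w arbitrary: p)
  case (Cons x w)
  then show ?case by (cases x) (simp add: inv_word_def step_cancel)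
qed simp

section \<open>Counting letters\<close>

text \<open>The point \<open>p\<close> is to the left of \<open>q\<close>, and \<open>c\<close> measures how long they stay together: it is the
  number of stretchings of their common interval that put them into different intervals. A letter
  that acts on both points changes \<open>c\<close> as much as the depth of \<open>q\<close>, so that \<open>c\<close> minus the depth of \<open>q\<close> changes only
  with letters that stretch or compress \<open>q\<close> but not \<open>p\<close>.\<close>

fun apart :: "track \<Rightarrow> track \<Rightarrow> int \<Rightarrow> bool" where
  "apart (Track j s d t) (Track j' s' d' t') c \<longleftrightarrow>
     j < j' \<and> c = 0 \<or>
     j = j' \<and> (\<exists>cs x y. s = cs @- False ## x \<and> s' = cs @- True ## y \<and> c = int (length cs) + 1)"

lemma apart_nonneg: "apart p q c \<Longrightarrow> c \<ge> 0"
  by (cases p; cases q) auto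

lemma apart_Cons:
  "apart (Track j s d t) (Track j s' d' t') c \<Longrightarrow>
   apart (Track i (b ## s) e u) (Track i (b ## s') e' u') (c + 1)"
  by clarsimp (metis (no_types) length_Cons add.commute of_nat_Suc shift.simps(2))

text \<open>The left-hand side of the inequality is two for a generator acting at or left of \<open>q\<close>, zero
  for such an inverse, and one for letters acting to the right of \<open>q\<close>. In the bound, a generator
  contributes at most once: if it stretches \<open>p\<close> and \<open>q\<close> together, the drop of \<open>c\<close> offsets that of the
  depth of \<open>q\<close>.\<close>

lemma step_bound:
  assumes "apart p q c"
  shows "\<exists>c'. apart (step (k, b) p) (step (k, b) q) c' \<and>
    1 + level (step (k, b) q) - level q \<ge>
      2 * (max 0 (depth p - depth (step (k, b) p)) + of_bool (k = 0 \<and> b) + (depth q - depth (step (k, b) q)) + c' - c)"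
proof -
  obtain j s d t j' s' d' t' where pq: "p = Track j s d t" "q = Track j' s' d' t'"
    by (metis track.exhaust)
  consider "j < j'" "c = 0" | cs x y where "j = j'" "s = cs @- False ## x" "s' = cs @- True ## y" "c = int (length cs) + 1"
    using assms pq by auto
  then show ?thesis
  proof cases
    case 1
    show ?thesis
    \<comment> \<open>This is the only way in which points of different intervals get into a common one.\<close>
    proof (cases "\<not> b \<and> k > 0 \<and> j = int k \<and> j' = int k + 1")
      case True
      have "apart (Track j (False ## s) (d + 1) (t - 1)) (Track j (True ## s') (d' + 1) (t' - 1)) 1"
        by (auto intro!: exI[of _ "[]"])
      then show ?thesis using 1 pq True by (intro exI[of _ 1]) auto
    next
      case False
      then show ?thesis using 1 pq
        by (intro exI[of _ 0]) (cases b; auto)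
    qed
  next
    case 2
    show ?thesis
    proof (cases "k > 0 \<and> j = int k \<and> b")
      case True
      show ?thesis
      proof (cases cs)
        case Nil
        then show ?thesis using 2 pq True by (intro exI[of _ 0]) auto
      next
        case (Cons b' cs')
        then show ?thesis using 2 pq True by (intro exI[of _ "int (length cs')+1"]) auto
      qed
    next
      case False
      show ?thesis
      proof (cases "k > 0 \<and> j \<le> int k + 1 \<and> j \<ge> int k \<and> \<not> b")
        case True
        have "apart (down k p) (down k q) (c + 1)"
          using apart_Cons[of j s d t s' d' t' c] assms True 2(1) pq by auto
        then show ?thesis using 2 pq True False by (intro exI[of _ "c+1"]) auto
      next
        case F: False
        have "apart (step (k, b) p) (step (k, b) q) c"
          using assms F False 2(1) pq by (cases b) auto
        then show ?thesis using 2(1) pq F False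
          by (intro exI[of _ "c"]) (cases b; auto)
      qed
    qed
  qed
qed

text \<open>Three kinds of generators are forced and pairwise different: those that stretch \<open>p\<close>, down to the least
  depth reached at any prefix \<open>v\<close>; an occurrence of \<open>x\<^sub>0\<close>; and those that stretch \<open>q\<close> but not \<open>p\<close>.
  Each of them costs two letters, up to the total change of the level of \<open>q\<close>.\<close>

lemma length_bound:
  assumes "apart p q 0"
  shows "\<exists>c. apart (act w p) (act w q) c \<and>
   (\<forall>v v'. w = v @ v' \<longrightarrow>
     int (length w) + level (act w q) - level q \<ge>
      2 * ((depth p - depth (act v p)) + of_bool ((0, True) \<in> set w) + (depth q - depth (act w q)) + c))"
proof (induction w rule: rev_induct)
  case Nil
  then show ?case using assms by auto
next
  case (snoc x w)
  obtain k b where x: "x = (k, b)" by (cases x)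
  from snoc obtain c where c: "apart (act w p) (act w q) c"
   "\<And>v v'. w = v @ v' \<Longrightarrow>
     int (length w) + level (act w q) - level q \<ge>
      2 * ((depth p - depth (act v p)) + of_bool ((0, True) \<in> set w) + (depth q - depth (act w q)) + c)"
    by blast
  obtain c' where c': "apart (step x (act w p)) (step x (act w q)) c'"
    "1 + level (step x (act w q)) - level (act w q) \<ge>
      2 * (max 0 (depth (act w p) - depth (step x (act w p))) + of_bool (k = 0 \<and> b)
        + (depth (act w q) - depth (step x (act w q))) + c' - c)"
    using step_bound[OF c(1), of k b] x by auto
  define M where "M = max 0 (depth (act w p) - depth (step x (act w p)))"
  have M: "M \<ge> 0" "M \<ge> depth (act w p) - depth (step x (act w p))"
    by (simp_all add: M_def)
  define o1 o2 o3 :: int where o_def: "o1 = of_bool ((0, True) \<in> set w)"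
    "o2 = of_bool (k = 0 \<and> b)" "o3 = of_bool ((0, True) \<in> set (w @ [x]))"
  have len: "int (length (w @ [x])) = int (length w) + 1"
    by simp
  have o: "o3 \<le> o1 + o2"
    using x by (auto simp: o_def)
  show ?case
  proof (intro exI[of _ c'] conjI allI impI)
    show "apart (act (w @ [x]) p) (act (w @ [x]) q) c'" using c'(1) by simp
    fix v v' assume v: "w @ [x] = v @ v'"
    then consider "v = w @ [x]" | v'' where "w = v @ v''"
      by (metis append_butlast_last_id append_is_Nil_conv butlast_append butlast_snoc append_Nil2)
    then show "int (length (w @ [x])) + level (act (w @ [x]) q) - level q \<ge>
      2 * ((depth p - depth (act v p)) + of_bool ((0, True) \<in> set (w @ [x])) + (depth q - depth (act (w @ [x]) q)) + c')"
    proof cases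
      case 1
      show ?thesis
        unfolding 1 len act_simps o_def(3)[symmetric]
        using c(2)[OF append_Nil2[symmetric]] c'(2) o M
        unfolding o_def[symmetric] M_def[symmetric] by (smt (verit))
    next
      case 2
      then show ?thesis
        using c(2)[OF 2] c'(2) o M unfolding o_def[symmetric] M_def[symmetric] len act_simps by (smt (verit))
    qed
  qed
qed

text \<open>Only \<open>x\<^sub>0\<close> moves points from the intervals numbered at most \<open>0\<close> to where they can be deformed.\<close>

lemma untouched:
  assumes "(0, True) \<notin> set w" "leaf p \<le> 0"
  shows "leaf (act w p) \<le> 0 \<and> depth (act w p) = depth p"
  using assms
proof (induction w arbitrary: p)
  case (Cons x w)
  obtain k b where x: "x = (k, b)" by (cases x)
  have "leaf (step x p) \<le> 0 \<and> depth (step x p) = depth p"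
    using Cons.prems x by (cases p; cases b) auto
  then show ?case using Cons by auto
qed simp

text \<open>Digits of the right end of an interval, approached from the left.\<close>

definition trues :: "bool stream" where
  "trues = sconst True"

lemma trues_simps [simp]: "shd trues" "stl trues = trues"
  by (simp_all add: trues_def)

text \<open>For a point that starts as the right end of an interval the level can be read off its
  position: stretching turns a leading digit \<open>1\<close> into a step to the next interval, and merely
  removes a leading digit \<open>0\<close>. So the level is the leaf minus the number of digits \<open>0\<close>.\<close>

lemma level_eq_leaf_minus_zeros:
  "\<exists>cs. addr (act w (Track j (trues) d j)) = cs @- trues \<and>
     level (act w (Track j (trues) d j)) =
     leaf (act w (Track j (trues) d j)) - int (length (filter Not cs))"
proof (induction w rule: rev_induct)
  case Nil
  show ?case by (intro exI[of _ "[]"]) simp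
next
  case (snoc x w)
  obtain k b where x: "x = (k, b)" by (cases x)
  obtain i s e t where q: "act w (Track j (trues) d j) = Track i s e t"
    by (metis track.exhaust)
  from snoc obtain cs where cs: "s = cs @- trues" "t = i - int (length (filter Not cs))"
    unfolding q track.sel by blast
  show ?case
  proof (cases b)
    case True
    show ?thesis
    proof (cases "k > 0 \<and> i = int k")
      case i: True
      show ?thesis using q x cs True i
        by (intro exI[of _ "tl cs"]) (cases cs; auto)
    next
      case False
      then show ?thesis using q x cs True by (intro exI[of _ cs]) auto
    qed
  next
    case False
    show ?thesis
    proof (cases "k > 0 \<and> i \<ge> int k \<and> i \<le> int k + 1")
      case i: True
      show ?thesis using q x cs False i
        by (intro exI[of _ "(i = int k + 1) # cs"]) auto
    next
      case F: False
      then show ?thesis using q x cs False by (intro exI[of _ cs]) auto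
    qed
  qed
qed

text \<open>The points of interval \<open>j\<close> whose first \<open>N\<close> digits are \<open>0\<close> form a dyadic interval of length
  \<open>2\<^sup>-\<^sup>N\<close>. As long as it is stretched at most \<open>N\<close> times, it stays within one unit interval and is
  mapped affinely, so all its points have the same depth.\<close>

lemma block_moves:
  assumes "\<And>v v'. w = v @ v' \<Longrightarrow> depth (act v (Track j (replicate N False @- s) 0 0)) \<ge> - int N"
  shows "\<exists>i cs t. \<forall>x. act w (Track j (replicate N False @- x) 0 0) = Track i (cs @- x) (int (length cs) - int N) t"
  using assms
proof (induction w rule: rev_induct)
  case Nil
  show ?case by (intro exI[of _ j] exI[of _ "replicate N False"] exI[of _ 0]) simp
next
  case (snoc y w)
  obtain k b where y: "y = (k, b)" by (cases y)
  obtain i cs t where IH: "\<And>x. act w (Track j (replicate N False @- x) 0 0) = Track i (cs @- x) (int (length cs) - int N) t"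
    using snoc.IH snoc.prems by (metis append.assoc)
  show ?case
  proof (cases b)
    case True
    show ?thesis
    proof (cases "k > 0 \<and> i = int k")
      case i: True
      have "cs \<noteq> []"
        using snoc.prems[of "w @ [y]" "[]"] IH[of s] i y True by auto
      then obtain c cs' where "cs = c # cs'" by (cases cs) auto
      then show ?thesis using IH y True i
        by (intro exI[of _ "if c then i + 1 else i"] exI[of _ cs'] exI[of _ "t+1"]) auto
    next
      case False
      then show ?thesis using IH y True
        by (intro exI[of _ "if k > 0 \<and> i < int k then i else i+1"] exI[of _ cs] exI[of _ "if k > 0 \<and> i < int k then t else t+1"]) auto
    qed
  next
    case False
    show ?thesis
    proof (cases "k > 0 \<and> i \<ge> int k \<and> i \<le> int k + 1")
      case i: True
      show ?thesis using IH y False i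
        by (intro exI[of _ "int k"] exI[of _ "(i = int k + 1) # cs"] exI[of _ "t-1"]) auto
    next
      case F: False
      then show ?thesis using IH y False
        by (intro exI[of _ "if k > 0 \<and> i < int k then i else i-1"] exI[of _ cs] exI[of _ "if k > 0 \<and> i < int k then t else t-1"]) auto
    qed
  qed
qed

section \<open>The two elements\<close>

definition core :: "nat \<Rightarrow> nat word" where
  "core K = replicate K (1, True) @ (0, True) # replicate K (1, False)"

lemma act_pow_up:
  "j \<ge> 2 \<Longrightarrow> act (replicate K (1, True)) (Track j s d t) = Track (j + int K) s d (t + int K)"
  "act (replicate K (1, True)) (Track 0 s d t) = Track 0 s d t"
  "act (replicate K (1, True)) (Track 1 (replicate K False @- s) d t) = Track 1 s (d - int K) (t + int K)"
  by (induction K arbitrary: j s d t) auto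

lemma shift_replicate_same: "replicate K b @- b ## s = b ## replicate K b @- s"
  by (induction K) auto

lemma act_pow_down:
  "j \<ge> int K + 2 \<Longrightarrow> act (replicate K (1, False)) (Track j s d t) = Track (j - int K) s d (t - int K)"
  "act (replicate K (1, False)) (Track 1 s d t) = Track 1 (replicate K False @- s) (d + int K) (t - int K)"
  by (induction K arbitrary: j s d t) (auto simp: shift_replicate_same)

text \<open>The last two equations exhibit the break inside the first interval: of two neighbouring
  intervals of length \<open>2\<^sup>-\<^sup>N\<close>, where \<open>N\<close> is the exponent in the core, the left one is moved without
  distortion, the right one is stretched once.\<close>

lemma act_core:
  "j \<ge> 2 \<Longrightarrow> act (core K) (Track j s d t) = Track (j + 1) s d (t + 1)"
  "act (core (Suc K)) (Track 0 s d t) = Track 1 (replicate (Suc K) False @- s) (d + int (Suc K)) (t - int K)"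
  "act (core (Suc K)) (Track 1 (replicate K False @- False ## s) d t) =
     Track 1 (replicate K False @- True ## s) d (t + 1)"
  "act (core (Suc (Suc K))) (Track 1 (replicate (Suc K) False @- True ## s) d t) =
     Track 1 (replicate K False @- True ## s) (d - 1) (t + 1)"
proof -
  show "act (core K) (Track j s d t) = Track (j + 1) s d (t + 1)" if "j \<ge> 2"
    using that by (simp add: core_def act_pow_up act_pow_down)
  show "act (core (Suc K)) (Track 0 s d t) = Track 1 (replicate (Suc K) False @- s) (d + int (Suc K)) (t - int K)"
    by (simp add: core_def act_pow_up(2) act_pow_down(2) del: replicate_Suc)
  have pow: "replicate (Suc K) x = replicate K x @ [x]" for K and x :: 'z
    by (simp add: replicate_append_same)
  show "act (core (Suc K)) (Track 1 (replicate K False @- False ## s) d t) =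
     Track 1 (replicate K False @- True ## s) d (t + 1)"
    unfolding core_def pow[of K "(1, True)"]
    by (simp add: act_pow_up(3) act_pow_down(2))
  show "act (core (Suc (Suc K))) (Track 1 (replicate (Suc K) False @- True ## s) d t) =
     Track 1 (replicate K False @- True ## s) (d - 1) (t + 1)"
    unfolding core_def pow[of "Suc K" "(1, True)"] act_simps act_pow_up(3)
    by (simp add: act_pow_down(2))
qed

section \<open>Words and the Cayley graph\<close>

definition cls :: "nat word \<Rightarrow> nat word set" where
  "cls w = word_eq F_rels `` {w}"

lemma cls_eq_iff: "cls u = cls v \<longleftrightarrow> (u, v) \<in> word_eq F_rels"
  using eq_equiv_class_iff[OF equiv_word_eq] by (simp add: cls_def)

lemma act_cls: "cls u = cls v \<Longrightarrow> act u = act v"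
  by (auto simp: cls_eq_iff act_word_eq)

lemma cls_mult: "cls u \<otimes>\<^bsub>thompson_F\<^esub> cls v = cls (u @ v)"
  by (simp add: cls_def thompson_F_def mult_class)

lemma cls_one: "\<one>\<^bsub>thompson_F\<^esub> = cls []"
  by (simp add: cls_def thompson_F_def one_presented_group)

lemma carrier_cls: "carrier thompson_F = range cls"
  by (simp add: cls_def thompson_F_def carrier_presented_group)

lemma thompson_gen_cls: "thompson_gen k = cls [(k, True)]"
  by (simp add: cls_def thompson_gen_def)

lemma cls_inv: "inv\<^bsub>thompson_F\<^esub> cls u = cls (inv_word u)"
proof -
  interpret group thompson_F by (rule group_thompson_F)
  show ?thesis
    by (rule inv_equality)
      (auto simp: cls_mult cls_one cls_eq_iff inv_word_def word_eq_inverse carrier_cls)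
qed

definition letters_upto :: "nat \<Rightarrow> nat word \<Rightarrow> bool" where
  "letters_upto n w \<longleftrightarrow> fst ` set w \<subseteq> {..n}"

lemma letters_upto_simps [simp]:
  "letters_upto n []" "letters_upto n (x # w) \<longleftrightarrow> fst x \<le> n \<and> letters_upto n w"
  "letters_upto n (v @ w) \<longleftrightarrow> letters_upto n v \<and> letters_upto n w"
  "letters_upto n (inv_word w) \<longleftrightarrow> letters_upto n w"
  "letters_upto n (replicate k x) \<longleftrightarrow> k = 0 \<or> fst x \<le> n"
  by (auto simp: letters_upto_def inv_word_def image_subset_iff set_replicate_conv_if)

lemma sym_gens_cls:
  "sym_gens thompson_F (thompson_gen ` {0..n}) = (\<lambda>x. cls [x]) ` {x. fst x \<le> n}"
proof -
  have "{x. fst x \<le> n} = (\<lambda>k. (k, True)) ` {0..n} \<union> (\<lambda>k. (k, False)) ` {0..n}"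
    by (auto simp: image_iff)
  then show ?thesis
    unfolding sym_gens_def by (simp add: image_Un image_image thompson_gen_cls cls_inv inv_word_def)
qed

lemma gen_products:
  "(\<exists>xs. length xs = m \<and> set xs \<subseteq> sym_gens thompson_F (thompson_gen ` {0..n}) \<and>
      g = foldr (\<otimes>\<^bsub>thompson_F\<^esub>) xs \<one>\<^bsub>thompson_F\<^esub>) \<longleftrightarrow>
   (\<exists>w. length w = m \<and> letters_upto n w \<and> g = cls w)"
  (is "?lhs \<longleftrightarrow> _")
proof -
  have reindex: "(\<exists>xs. P xs \<and> (\<exists>w. L w \<and> xs = f w) \<and> Q xs) \<longleftrightarrow> (\<exists>w. P (f w) \<and> L w \<and> Q (f w))"
    for P Q :: "nat word set list \<Rightarrow> bool" and L :: "nat word \<Rightarrow> bool" and f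
    by blast
  have foldr_cls: "foldr (\<otimes>\<^bsub>thompson_F\<^esub>) (map (\<lambda>x. cls [x]) w) \<one>\<^bsub>thompson_F\<^esub> = cls w" for w
    by (induction w) (simp_all add: cls_one cls_mult)
  have letters: "letters_upto n w \<longleftrightarrow> w \<in> lists {x. fst x \<le> n}" for w
    by (auto simp: letters_upto_def lists_eq_set)
  have set_cls: "set xs \<subseteq> sym_gens thompson_F (thompson_gen ` {0..n}) \<longleftrightarrow>
      (\<exists>w. letters_upto n w \<and> xs = map (\<lambda>x. cls [x]) w)" for xs
  proof -
    have "set xs \<subseteq> (\<lambda>x. cls [x]) ` A \<longleftrightarrow> xs \<in> map (\<lambda>x. cls [x]) ` lists A" for A
      by (simp only: lists_image[symmetric] in_lists_conv_set subset_iff Ball_def)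
    then show ?thesis
      unfolding sym_gens_cls letters by (simp only: image_iff Bex_def)
  qed
  have "?lhs \<longleftrightarrow> (\<exists>w. length (map (\<lambda>x. cls [x]) w) = m \<and> letters_upto n w \<and>
      g = foldr (\<otimes>\<^bsub>thompson_F\<^esub>) (map (\<lambda>x. cls [x]) w) \<one>\<^bsub>thompson_F\<^esub>)"
    unfolding set_cls by (rule reindex[where P = "\<lambda>xs. length xs = m" and f = "map (\<lambda>x. cls [x])"
        and Q = "\<lambda>xs. g = foldr (\<otimes>\<^bsub>thompson_F\<^esub>) xs \<one>\<^bsub>thompson_F\<^esub>"])
  then show ?thesis
    unfolding foldr_cls length_map .
qed

lemma word_dist_cls:
  "word_dist thompson_F (thompson_gen ` {0..n}) (cls u) (cls v) =
    (LEAST m. \<exists>w. length w = m \<and> letters_upto n w \<and> cls (inv_word u @ v) = cls w)"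
  unfolding word_dist_def gen_products cls_inv cls_mult ..

lemma exists_letters_upto:
  assumes "n \<ge> 1"
  shows "\<exists>w. letters_upto n w \<and> cls u = cls w"
proof -
  have sym: "\<exists>w. letters_upto n w \<and> g = cls w" if g: "g \<in> sym_gens thompson_F (thompson_gen ` {0..n})" for g
  proof -
    obtain x where "g = cls [x]" "fst x \<le> n"
      using g unfolding sym_gens_cls by blast
    then show ?thesis by (intro exI[of _ "[x]"]) simp
  qed
  have "\<exists>w. letters_upto n w \<and> g = cls w" if "g \<in> generate thompson_F (thompson_gen ` {0..n})" for g
    using that
  proof induction
    case one
    then show ?case by (intro exI[of _ "[]"]) (simp add: cls_one)
  next
    case (incl h)
    then show ?case by (intro sym) (simp add: sym_gens_def)
  next
    case (inv h)
    then show ?case by (intro sym) (simp add: sym_gens_def)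
  next
    case (eng h1 h2)
    then obtain w1 w2 where "letters_upto n w1" "letters_upto n w2" "h1 = cls w1" "h2 = cls w2"
      by blast
    then show ?case by (intro exI[of _ "w1 @ w2"]) (simp add: cls_mult)
  qed
  moreover have "cls u \<in> generate thompson_F (thompson_gen ` {0..n})"
    unfolding generate_thompson_F[OF assms] carrier_cls by simp
  ultimately show ?thesis by blast
qed

lemma in_word_ball:
  assumes "n \<ge> 1"
  shows "cls u \<in> word_ball thompson_F (thompson_gen ` {0..n}) m \<longleftrightarrow>
    (\<exists>w. length w \<le> m \<and> letters_upto n w \<and> cls u = cls w)"
proof -
  define P where "P = (\<lambda>k. \<exists>w. length w = k \<and> letters_upto n w \<and> cls u = cls w)"
  have "cls u \<in> carrier thompson_F"
    by (simp add: carrier_cls)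
  moreover have "word_dist thompson_F (thompson_gen ` {0..n}) \<one>\<^bsub>thompson_F\<^esub> (cls u) = (LEAST k. P k)"
    unfolding cls_one word_dist_cls P_def by simp
  ultimately have ball: "cls u \<in> word_ball thompson_F (thompson_gen ` {0..n}) m \<longleftrightarrow> (LEAST k. P k) \<le> m"
    by (simp add: word_ball_def)
  obtain w where "letters_upto n w" "cls u = cls w"
    using exists_letters_upto[OF assms] by blast
  then have "P (length w)"
    unfolding P_def by blast
  then have "P (LEAST k. P k)"
    by (rule LeastI)
  show ?thesis
  proof
    assume "cls u \<in> word_ball thompson_F (thompson_gen ` {0..n}) m"
    with ball \<open>P (LEAST k. P k)\<close> show "\<exists>w. length w \<le> m \<and> letters_upto n w \<and> cls u = cls w"
      unfolding P_def by metis
  next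
    assume "\<exists>w. length w \<le> m \<and> letters_upto n w \<and> cls u = cls w"
    then obtain w where w: "length w \<le> m" "letters_upto n w" "cls u = cls w" by blast
    then have "P (length w)" unfolding P_def by blast
    then have "(LEAST k. P k) \<le> length w" by (rule Least_le)
    with w(1) ball show "cls u \<in> word_ball thompson_F (thompson_gen ` {0..n}) m" by linarith
  qed
qed

lemma path_word:
  assumes "cayley_path thompson_F (thompson_gen ` {0..n}) (cls u) p h"
  shows "\<exists>w. letters_upto n w \<and> length w = path_length p \<and> h = cls (u @ w) \<and>
    (\<forall>v v'. w = v @ v' \<longrightarrow> cls (u @ v) \<in> set p)"
  using assms
proof (induction p arbitrary: u)
  case Nil
  then show ?case by (simp add: cayley_path_def)
next
  case (Cons g p)
  have g: "g = cls u" using Cons.prems by (simp add: cayley_path_def)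
  show ?case
  proof (cases p)
    case Nil
    then have "h = cls (u @ [])" "path_length (g # p) = 0"
      using Cons.prems g by (simp_all add: cayley_path_def path_length_def)
    then show ?thesis
      using g by (intro exI[of _ "[]"]) simp
  next
    case p: (Cons g' p')
    then have "\<exists>y\<in>sym_gens thompson_F (thompson_gen ` {0..n}). g' = cls u \<otimes>\<^bsub>thompson_F\<^esub> y"
      using Cons.prems g by (simp add: cayley_path_def cayley_adj_def)
    then obtain x where x: "fst x \<le> n" "g' = cls (u @ [x])"
      unfolding sym_gens_cls by (metis (no_types, lifting) cls_mult imageE mem_Collect_eq)
    have "cayley_path thompson_F (thompson_gen ` {0..n}) (cls (u @ [x])) p h"
      using Cons.prems p x by (simp add: cayley_path_def)
    from Cons.IH[OF this] obtain w where w: "letters_upto n w" "length w = path_length p"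
      "h = cls ((u @ [x]) @ w)" "\<forall>v v'. w = v @ v' \<longrightarrow> cls ((u @ [x]) @ v) \<in> set p"
      by blast
    have "cls (u @ v) \<in> set (g # p)" if v: "x # w = v @ v'" for v v'
    proof (cases v)
      case Nil
      then show ?thesis by (simp add: g)
    next
      case (Cons y v'')
      then have "w = v'' @ v'" "y = x" using v by simp_all
      then show ?thesis using w(4) Cons by simp
    qed
    then show ?thesis
      using w(1-3) x(1) p by (intro exI[of _ "x # w"]) (simp add: path_length_def)
  qed
qed

text \<open>A letter \<open>x\<^sub>k\<^sup>-\<^sup>1\<close> deepens only the points of the intervals \<open>k\<close> and \<open>k + 1\<close>.\<close>

lemma depth_crossing:
  assumes "depth (act v p) < 0" "depth (act (v @ w) p) \<ge> 0"
  shows "\<exists>w1 k b w2. w = w1 @ (k, b) # w2 \<and> depth (act (v @ w1) p) < 0 \<and> leaf (act (v @ w1) p) \<le> int k + 1"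
  using assms
proof (induction w arbitrary: v)
  case Nil
  then show ?case by simp
next
  case (Cons x w)
  obtain k b where x: "x = (k, b)" by (cases x)
  show ?case
  proof (cases "depth (act (v @ [x]) p) < 0")
    case True
    then obtain w1 k b w2 where "w = w1 @ (k, b) # w2" "depth (act ((v @ [x]) @ w1) p) < 0"
      "leaf (act ((v @ [x]) @ w1) p) \<le> int k + 1"
      using Cons.IH[of "v @ [x]"] Cons.prems by auto
    then show ?thesis by (intro exI[of _ "x # w1"] exI[of _ k] exI[of _ b] exI[of _ w2]) auto
  next
    case False
    then have "leaf (act v p) \<le> int k + 1"
      using Cons.prems(1) x by (cases "act v p"; cases b) (auto split: if_splits)
    then show ?thesis
      using Cons.prems(1) x by (intro exI[of _ "[]"]) auto
  qed
qed

section \<open>The break of the core and the cost of undoing it\<close>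

text \<open>The tips are points next to the break of the core, one in each of the two halves of the leftmost dyadic
  interval of length \<open>2\<^sup>-\<^sup>(\<^sup>K\<^sup>+\<^sup>1\<^sup>)\<close> in the first unit interval; the exponent in the core will be \<open>K + 2\<close>.\<close>

definition tip :: "nat \<Rightarrow> bool \<Rightarrow> track" where
  "tip K b = Track 1 (replicate (Suc K) False @- b ## trues) 0 0"

definition origin :: track where
  "origin = Track 0 trues 0 0"

text \<open>The level starts at the leaf so that \<open>level_eq_leaf_minus_zeros\<close> applies.\<close>

definition gate :: "nat \<Rightarrow> track" where
  "gate n = Track (int n) trues 0 (int n)"

text \<open>Letters cannot act differently on the two tips before they have been stretched into different unit intervals.\<close>

lemma tips_split:
  assumes "depth (act w (tip K False)) \<noteq> depth (act w (tip K True))"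
  shows "\<exists>v v'. w = v @ v' \<and> depth (act v (tip K False)) < - int (Suc K)"
proof (rule ccontr)
  assume "\<not> ?thesis"
  then have ge: "- int (Suc K) \<le> depth (act v (Track 1 (replicate (Suc K) False @- False ## trues) 0 0))"
    if "w = v @ v'" for v v'
    using that unfolding tip_def not_less[symmetric] by blast
  have "\<exists>i cs t. \<forall>x. act w (Track 1 (replicate (Suc K) False @- x) 0 0) =
      Track i (cs @- x) (int (length cs) - int (Suc K)) t"
    by (rule block_moves) (rule ge)
  then obtain i cs t where "\<And>x. act w (Track 1 (replicate (Suc K) False @- x) 0 0) =
      Track i (cs @- x) (int (length cs) - int (Suc K)) t"
    by blast
  then show False
    using assms unfolding tip_def by (metis track.sel(3))
qed

text \<open>One positive letter stretches the gate, which leaves at most \<open>K + 2\<close> others. If \<open>x\<^sub>0\<close> is one of them, then at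
  most \<open>K + 1\<close> stretch the tip.\<close>

lemma history_dichotomy:
  assumes n: "n \<ge> 2"
    and len: "length w \<le> 2 * K + 6"
    and gate: "level (act w (gate n)) \<le> int n + 1" "depth (act w (gate n)) < 0"
  shows "(0, True) \<notin> set w \<or> (\<forall>v v'. w = v @ v' \<longrightarrow> - int (Suc K) \<le> depth (act v (tip K False)))"
proof (rule imp_conv_disj[THEN iffD1, of "(0, True) \<in> set w"], intro allI impI)
  fix v v' assume w: "(0, True) \<in> set w" "w = v @ v'"
  have "apart (tip K False) (gate n) 0"
    using n by (simp add: tip_def gate_def)
  from length_bound[OF this, of w] obtain c where
    "apart (act w (tip K False)) (act w (gate n)) c"
    "int (length w) + level (act w (gate n)) - level (gate n) \<ge>
      2 * (depth (tip K False) - depth (act v (tip K False)) + of_bool ((0, True) \<in> set w) +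
        (depth (gate n) - depth (act w (gate n))) + c)"
    using w by blast
  with apart_nonneg[OF this(1)] w(1) len gate
  show "- int (Suc K) \<le> depth (act v (tip K False))"
    by (simp add: tip_def gate_def)
qed

text \<open>Here \<open>g\<close> is one of the two elements, \<open>y\<close> is a path from it to the vertex at which the gate
  closes, and \<open>w\<close> is a short word for that vertex. If \<open>w\<close> avoids \<open>x\<^sub>0\<close>, it leaves the origin
  undeformed, and \<open>y\<close> must undo its depth \<open>K + 2\<close>. Otherwise \<open>w\<close> followed by the reverse of \<open>y\<close> is a
  word for \<open>g\<close>, which separates the tips, and this happens on the part coming from \<open>y\<close>. Either way some
  prefix of \<open>y\<close> lowers the depth of a point left of the gate by \<open>K + 2\<close>. The summand in \<open>of_bool\<close> accounts
  for the \<open>x\<^sub>0\<close> that is needed if both points start out of reach.\<close>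

lemma undoing_cost:
  assumes eq: "act (g @ y) = act w"
    and hist: "(0, True) \<notin> set w \<or> (\<forall>v v'. w = v @ v' \<longrightarrow> - int (Suc K) \<le> depth (act v (tip K False)))"
    and tips: "depth (act g (tip K False)) = 0" "depth (act g (tip K True)) = - 1"
    and origin: "depth (act g origin) = int K + 2"
    and left: "leaf (act g (tip K False)) < leaf (act g (gate n))" "leaf (act g origin) < leaf (act g (gate n))"
  shows "int (length y) + level (act w (gate n)) - level (act g (gate n)) \<ge>
      2 * (int K + 2 + of_bool (leaf (act g (tip K False)) \<le> 0 \<and> leaf (act g origin) \<le> 0)
        + (depth (act g (gate n)) - depth (act w (gate n))))"
proof -
  \<comment> \<open>Which of the two points is forced to be stretched depends on how \<open>w\<close> reaches the vertex.\<close>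
  have "\<exists>p v v'. p \<in> {tip K False, origin} \<and> y = v @ v' \<and>
      depth (act g p) - depth (act v (act g p)) \<ge> int K + 2"
  proof (cases "(0, True) \<in> set w")
    case False
    then have "depth (act w origin) = 0"
      using untouched[of w origin] by (simp add: origin_def)
    then have "depth (act y (act g origin)) = 0"
      using eq by (metis act_simps(3))
    then show ?thesis
      using origin by (intro exI[of _ origin] exI[of _ y] exI[of _ "[]"]) simp
  next
    case True
    have eq': "act (w @ inv_word y) p = act g p" for p
      using eq by (metis act_simps(3) act_inv_word)
    then obtain v v' where v: "w @ inv_word y = v @ v'" "depth (act v (tip K False)) < - int (Suc K)"
      using tips_split[of "w @ inv_word y" K] tips by auto
    \<comment> \<open>The separation does not happen within \<open>w\<close>, so it happens after the path has entered \<open>y\<close>.\<close>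
    have "\<not> (\<exists>v''. w = v @ v'')"
      using v(2) hist True by (metis not_le)
    then obtain y' where y': "v = w @ y'" "inv_word y = y' @ v'"
      using v(1) by (auto simp: append_eq_append_conv2)
    then have y: "y = inv_word v' @ inv_word y'"
      by (metis inv_word_simps(2,4))
    have "act (w @ y') p = act (inv_word v') (act g p)" for p
      using y' eq' by (metis act_simps(3) act_inv_word append.assoc)
    then show ?thesis
      using v(2) y y'(1) tips(1)
      by (intro exI[of _ "tip K False"] exI[of _ "inv_word v'"] exI[of _ "inv_word y'"]) simp
  qed
  then obtain p v v' where p: "p \<in> {tip K False, origin}" and v: "y = v @ v'"
      "depth (act g p) - depth (act v (act g p)) \<ge> int K + 2"
    by blast
  have "apart (act g p) (act g (gate n)) 0"
    using p left by (cases "act g p"; cases "act g (gate n)") auto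
  from length_bound[OF this, of y] obtain c where
    c: "apart (act y (act g p)) (act y (act g (gate n))) c"
    "int (length y) + level (act y (act g (gate n))) - level (act g (gate n)) \<ge>
      2 * (depth (act g p) - depth (act v (act g p)) + of_bool ((0, True) \<in> set y) +
        (depth (act g (gate n)) - depth (act y (act g (gate n)))) + c)"
    using v(1) by blast
  have "(0, True) \<in> set y" if "leaf (act g p) \<le> 0"
  proof (rule ccontr)
    assume "(0, True) \<notin> set y"
    then have "(0, True) \<notin> set v" using v(1) by simp
    then show False using untouched[of v "act g p"] that v(2) by simp
  qed
  then have "of_bool (leaf (act g (tip K False)) \<le> 0 \<and> leaf (act g origin) \<le> 0)
      \<le> (of_bool ((0, True) \<in> set y) :: int)"
    using p by auto
  moreover have "act y (act g (gate n)) = act w (gate n)"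
    using eq by (metis act_simps(3))
  ultimately show ?thesis
    using c apart_nonneg[OF c(1)] v(2) by (smt (verit))
qed

section \<open>Failure of minimal almost convexity\<close>

definition start_word :: "nat \<Rightarrow> nat \<Rightarrow> nat word" where
  "start_word n K = (n, True) # core (K + 2)"

definition goal_word :: "nat \<Rightarrow> nat word" where
  "goal_word K = core (K + 2) @ [(0, False)]"

lemma act_start_word:
  assumes "n \<ge> 2"
  shows "act (start_word n K) (tip K False) = Track 1 (replicate (Suc K) False @- True ## trues) 0 1"
    "depth (act (start_word n K) (tip K True)) = - 1"
    "act (start_word n K) origin = Track 1 (replicate (K + 2) False @- trues) (int K + 2) (- int K - 1)"
    "act (start_word n K) (gate n) = Track (int n + 2) trues (- 1) (int n + 2)"
  using assms act_core(1)[of "int n + 1" "Suc (Suc K)"] act_core(2)[of "Suc K"] act_core(3)[of "Suc K"] act_core(4)[of K]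
  by (simp_all add: start_word_def tip_def origin_def gate_def del: replicate_Suc)

lemma act_goal_word:
  assumes "n \<ge> 2"
  shows "act (goal_word K) (tip K False) = Track 0 (replicate (Suc K) False @- True ## trues) 0 0"
    "depth (act (goal_word K) (tip K True)) = - 1"
    "act (goal_word K) origin = Track 0 (replicate (K + 2) False @- trues) (int K + 2) (- int K - 2)"
    "act (goal_word K) (gate n) = Track (int n) trues 0 (int n)"
  using assms act_core(1)[of "int n" "Suc (Suc K)"] act_core(2)[of "Suc K"] act_core(3)[of "Suc K"] act_core(4)[of K]
  by (simp_all add: goal_word_def tip_def origin_def gate_def del: replicate_Suc)

lemma cls_context: "cls u = cls v \<Longrightarrow> cls (a @ u @ b) = cls (a @ v @ b)"
  by (metis cls_mult)

lemma cls_cancel: "cls (u @ [(a, b), (a, \<not> b)] @ v) = cls (u @ v)"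
  by (simp only: cls_eq_iff word_eq.cancel)

lemma gen_past_pos:
  assumes "i < j"
  shows "cls [(j, True), (i, True)] = cls [(i, True), (Suc j, True)]"
proof -
  have "cls ([(i, False), (j, True), (i, True)]) = cls [(Suc j, True)]"
    using word_eq.rel[of _ _ F_rels "[]" "[]"] assms unfolding cls_eq_iff by auto
  from cls_context[OF this, of "[(i, True)]" "[]"] show ?thesis
    using cls_cancel[of "[]" i True "[(j, True), (i, True)]"] by simp
qed

lemma gen_past_neg:
  assumes "i < j"
  shows "cls [(Suc j, True), (i, False)] = cls [(i, False), (j, True)]"
proof -
  have "cls ([(i, False), (j, True), (i, True)]) = cls [(Suc j, True)]"
    using word_eq.rel[of _ _ F_rels "[]" "[]"] assms unfolding cls_eq_iff by auto
  from cls_context[OF this, of "[]" "[(i, False)]"] show ?thesis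
    using cls_cancel[of "[(i, False), (j, True)]" i True "[]"] by simp
qed

lemma gen_past_pos_power:
  assumes "j \<ge> 2"
  shows "cls ((j, True) # replicate K (1, True)) = cls (replicate K (1, True) @ [(j + K, True)])"
  using assms
proof (induction K arbitrary: j)
  case (Suc K)
  have "cls ((j, True) # replicate (Suc K) (1, True)) = cls ([(1, True)] @ (Suc j, True) # replicate K (1, True))"
    using cls_context[OF gen_past_pos[of 1 j], of "[]" "replicate K (1, True)"] Suc.prems by simp
  also have "\<dots> = cls ([(1, True)] @ replicate K (1, True) @ [(Suc j + K, True)])"
    using cls_context[OF Suc.IH[of "Suc j"], of "[(1, True)]" "[]"] Suc.prems by simp
  finally show ?case by simp
qed simp

lemma gen_past_neg_power:
  assumes "j \<ge> 2"
  shows "cls ((j + K, True) # replicate K (1, False)) = cls (replicate K (1, False) @ [(j, True)])"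
proof (induction K)
  case (Suc K)
  have "cls ((j + Suc K, True) # replicate (Suc K) (1, False)) = cls ([(1, False)] @ (j + K, True) # replicate K (1, False))"
    using cls_context[OF gen_past_neg[of 1 "j + K"], of "[]" "replicate K (1, False)"] assms by simp
  also have "\<dots> = cls ([(1, False)] @ replicate K (1, False) @ [(j, True)])"
    using cls_context[OF Suc.IH, of "[(1, False)]" "[]"] by simp
  finally show ?case by simp
qed simp

text \<open>The generator climbs by \<open>K + 1\<close> over the positive letters and comes down by \<open>K\<close> over the inverses.\<close>

lemma gen_past_core:
  assumes "n \<ge> 2"
  shows "cls ((n, True) # core K) = cls (core K @ [(Suc n, True)])"
proof -
  have "cls ((n, True) # core K) = cls (replicate K (1, True) @ [(n + K, True), (0, True)] @ replicate K (1, False))"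
    using cls_context[OF gen_past_pos_power[OF assms, of K], of "[]" "(0, True) # replicate K (1, False)"]
    by (simp add: core_def)
  also have "\<dots> = cls ((replicate K (1, True) @ [(0, True)]) @ ((Suc n + K, True) # replicate K (1, False)) @ [])"
    using cls_context[OF gen_past_pos[of 0 "n + K"], of "replicate K (1, True)" "replicate K (1, False)"] assms
    by simp
  also have "\<dots> = cls ((replicate K (1, True) @ [(0, True)]) @ (replicate K (1, False) @ [(Suc n, True)]) @ [])"
    using assms by (intro cls_context gen_past_neg_power) simp
  finally show ?thesis by (simp add: core_def)
qed

lemma start_to_goal:
  assumes "n \<ge> 2"
  shows "cls (start_word n K @ [(0, False), (n, False)]) = cls (goal_word K)"
proof -
  let ?c = "core (K + 2)"
  have "cls (start_word n K @ [(0, False), (n, False)]) = cls (?c @ [(Suc n, True), (0, False)] @ [(n, False)])"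
    using cls_context[OF gen_past_core[OF assms], of "[]" _ "[(0, False), (n, False)]"]
    by (simp add: start_word_def)
  also have "\<dots> = cls (?c @ [(0, False), (n, True)] @ [(n, False)])"
    using assms by (intro cls_context gen_past_neg) simp
  also have "\<dots> = cls (goal_word K)"
    using cls_cancel[of "?c @ [(0, False)]" n True "[]"] by (simp add: goal_word_def)
  finally show ?thesis .
qed

lemma level_change: "level p - level (act w p) \<le> int (length w)"
proof (induction w arbitrary: p)
  case (Cons x w)
  obtain k b where "x = (k, b)" by (cases x)
  then have "level p - level (step x p) \<le> 1"
    by (cases p; cases b) auto
  then show ?case using Cons[of "step x p"] by simp
qed simp

lemma dist_start_goal:
  assumes "n \<ge> 2"
  shows "word_dist thompson_F (thompson_gen ` {0..n}) (cls (start_word n K)) (cls (goal_word K)) = 2"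
  unfolding word_dist_cls
proof (rule Least_equality)
  let ?v = "inv_word (start_word n K)"
  have inv: "cls (?v @ start_word n K) = cls []"
    unfolding cls_eq_iff inv_word_def by (rule word_eq_inverse)
  have "cls (?v @ goal_word K) = cls ((?v @ start_word n K) @ [(0, False), (n, False)])"
    using cls_context[OF start_to_goal[OF assms, of K], of ?v "[]"] by simp
  also have "\<dots> = cls [(0, False), (n, False)]"
    using cls_context[OF inv, of "[]" "[(0, False), (n, False)]"] by simp
  finally show "\<exists>w. length w = 2 \<and> letters_upto n w \<and> cls (inv_word (start_word n K) @ goal_word K) = cls w"
    by (intro exI[of _ "[(0, False), (n, False)]"]) simp
next
  fix m assume "\<exists>w. length w = m \<and> letters_upto n w \<and> cls (inv_word (start_word n K) @ goal_word K) = cls w"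
  then obtain w where w: "length w = m" "cls (inv_word (start_word n K) @ goal_word K) = cls w" by blast
  have "act (inv_word (start_word n K) @ goal_word K) (act (start_word n K) (gate n)) = act w (act (start_word n K) (gate n))"
    by (simp only: act_cls[OF w(2)])
  then have "act w (act (start_word n K) (gate n)) = act (goal_word K) (gate n)"
    by simp
  then show "2 \<le> m"
    using level_change[of "act (start_word n K) (gate n)" w] w(1) act_start_word(4)[OF assms] act_goal_word(4)[OF assms]
    by simp
qed

theorem theorem4p1:
  fixes n :: nat
  assumes "n \<ge> 2"
  shows "\<not> minimally_almost_convex thompson_F (thompson_gen ` {0..n})"
proof
  let ?X = "thompson_gen ` {0..n}"
  assume "minimally_almost_convex thompson_F ?X"
  then obtain M where M: "\<And>m g h. m \<ge> M \<Longrightarrow> g \<in> word_ball thompson_F ?X m \<Longrightarrow> h \<in> word_ball thompson_F ?X m \<Longrightarrow>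
      word_dist thompson_F ?X g h = 2 \<Longrightarrow>
      \<exists>p. cayley_path thompson_F ?X g p h \<and> path_length p \<le> 2 * m - 1 \<and> set p \<subseteq> word_ball thompson_F ?X m"
    unfolding minimally_almost_convex_def by blast
  define m where "m = 2 * M + 6"
  let ?l = "start_word n M" and ?r = "goal_word M"
  have n: "n \<ge> 1" using assms by simp
  have "length ?l = m" "letters_upto n ?l" "length ?r = m" "letters_upto n ?r"
    using assms by (simp_all add: start_word_def goal_word_def core_def m_def)
  then have "cls ?l \<in> word_ball thompson_F ?X m" "cls ?r \<in> word_ball thompson_F ?X m"
    unfolding in_word_ball[OF n] by (metis order_refl)+
  from M[OF _ this dist_start_goal[OF assms]]
  obtain p where p: "cayley_path thompson_F ?X (cls ?l) p (cls ?r)"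
      "path_length p \<le> 2 * m - 1" "set p \<subseteq> word_ball thompson_F ?X m"
    by (auto simp: m_def)
  from path_word[OF p(1)] obtain w where w: "letters_upto n w" "length w = path_length p"
      "cls ?r = cls (?l @ w)" "\<And>v v'. w = v @ v' \<Longrightarrow> cls (?l @ v) \<in> set p"
    by blast
  have "depth (act ?l (gate n)) < 0" "depth (act (?l @ w) (gate n)) \<ge> 0"
    unfolding act_cls[OF w(3), symmetric] act_start_word(4)[OF assms] act_goal_word(4)[OF assms]
    by simp_all
  \<comment> \<open>The gate closes right after the prefix \<open>w1\<close>.\<close>
  then obtain w1 k b w2 where w12: "w = w1 @ (k, b) # w2"
      "depth (act (?l @ w1) (gate n)) < 0" "leaf (act (?l @ w1) (gate n)) \<le> int k + 1"
    using depth_crossing by blast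
  have "cls (?l @ w1) \<in> word_ball thompson_F ?X m"
    using w(4)[OF w12(1)] p(3) by blast
  then obtain h where h: "length h \<le> m" "cls (?l @ w1) = cls h"
    unfolding in_word_ball[OF n] by blast
  have act_h: "act (?l @ w1) = act h"
    by (rule act_cls[OF h(2)])
  have "k \<le> n" using w(1) w12(1) by simp
  then have level: "level (act h (gate n)) \<le> int n + 1"
    using level_eq_leaf_minus_zeros[of h "int n" 0] w12(3) unfolding act_h gate_def by auto
  have depth: "depth (act h (gate n)) < 0"
    using w12(2) unfolding act_h .
  note hist = history_dichotomy[OF assms h(1)[unfolded m_def] level depth]
  \<comment> \<open>From \<open>l\<close> the gate has to come down by one level.\<close>
  have 1: "int (length w1) \<ge> 2 * int M + 5"
    using undoing_cost[OF act_h hist, of n] act_start_word[OF assms, of M] level depth by simp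
  let ?y = "inv_word ((k, b) # w2)"
  have "act (?r @ ?y) p = act (?l @ w1) p" for p
    using act_cls[OF w(3)] w12(1) act_inv_word[of "(k, b) # w2"] by (metis act_simps(3) append.assoc)
  then have act_y: "act (?r @ ?y) = act h"
    using act_h by auto
  \<comment> \<open>Backwards from \<open>r\<close> the gate may rise by one level, but it must be stretched, and \<open>x\<^sub>0\<close> must occur.\<close>
  have 2: "int (length ?y) \<ge> 2 * int M + 7"
    using undoing_cost[OF act_y hist, of n] act_goal_word[OF assms, of M] level depth assms by simp
  show False
    using 1 2 w(2) w12(1) p(2) by (simp add: m_def)
qed

end
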